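(* For any $\sigma$-program $P$ and the standard order $\le_P$ on $\mathrm{Lab}_P$, the ordered set $(\mathrm{Lab}_P,\le_P)$ can be isomorphically embedded into $(\mathbb R,\le)$.
   Context: **Programs.** Let $\sigma=(n_1;m_1,\ldots,m_{n_2};k_1,\ldots,k_{n_3})$ be a finite signature with constant symbols $c_i^0$, operation symbols $f_i^{m_i}$, relation symbols $r_i^{k_i}$. A $\sigma$-program $P$ is a list $1:\mathrm{instruction}_1;\ \ldots;\ \ell_P-1:\mathrm{instruction}_{\ell_P-1};\ \ell_P:\text{stop}$ with $\ell_P\ge1$, where each instruction with label $\ell<\ell_P$ has one of the forms: (1) $Z_j:=f_i^{m_i}(Z_{j_1},\ldots,Z_{j_{m_i}})$; (2) $Z_j:=c_i^0$; (3) $Z_{I_j}:=Z_{I_k}$; (4) if $r_i^{k_i}(Z_{j_1},\ldots,Z_{j_{k_i}})$ then goto $\ell_1'$ else goto $\ell_2'$; (5) if $I_j=I_k$ then goto $\ell_1'$ else goto $\ell_2'$; (6) $I_j:=1$; (7) $I_j:=I_j+1$; (11) goto $\ell_1'$ or goto $\ell_2'$; with $\ell_1',\ell_2'\in L_P=\{1,\ldots,\ell_P\}$. Let $L_P^{\circ}=\{1,\ldots,\ell_P-1\}$, $L_P^{\mathrm B}$ = labels of types (4),(5),(11), $L_P^{\mathrm{NB}}=L_P^\circ\setminus L_P^{\mathrm B}$. Put $\beta_P(\ell)=\ell+1$ for $\ell\in L_P^{\mathrm{NB}}$ and, for $\ell\in L_P^{\mathrm B}$, $\beta_P^+(\ell)=\ell_1'$,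 $\beta_P^-(\ell)=\ell_2'$. **$P$-paths.** A finite $P$-path of length $s\ge1$ is $(\ell_1,\ldots,\ell_s)\in L_P^s$ with $\ell_1=1$, $\ell_s=\ell_P$, $\ell_t\in L_P^\circ$ for $t<s$, and for all $t<s$: $\ell_{t+1}=\beta_P(\ell_t)$ if $\ell_t\in L_P^{\mathrm{NB}}$, $\ell_{t+1}\in\{\beta_P^+(\ell_t),\beta_P^-(\ell_t)\}$ if $\ell_t\in L_P^{\mathrm B}$. An infinite $P$-path is $(\ell_1,\ell_2,\ldots)\in (L_P^\circ)^\omega$ with $\ell_1=1$ and the same successor rule for all $t\ge 1$. $\mathrm{Lab}_P$ is the set of all (finite and infinite) $P$-paths. **The order.** For $P$-paths $B^{(1)}=(\ell_{1,1},\ell_{1,2},\ldots)$ and $B^{(2)}=(\ell_{2,1},\ell_{2,2},\ldots)$ (each finite or infinite), $B^{(1)}<_PB^{(2)}$ holds iff there is $j\in\{2,3,\ldots\}$, not exceeding the length of any of the two paths that is finite, with $\ell_{1,i}=\ell_{2,i}$ for all $i\in\{1,\ldots,j-1\}$, $\ell_{1,j}\ne\ell_{2,j}$, $\ell_{1,j}=\beta_P^+(\ell_{1,j-1})$ and $\ell_{2,j}=\beta_P^-(\ell_{1,j-1})$. $B^{(1)}\le_PB^{(2)}$ means $B^{(1)}<_PB^{(2)}$ or $B^{(1)}=B^{(2)}$; $\le_P$ is called the standard order on $\mathrm{Lab}_P$. *)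

theory Defs
  imports Complex_Main "HOL-Library.Stream" "HOL-Library.Extended_Nat"
begin

text \<open>The signature \<open>(n\<^sub>1; m\<^sub>1, \<dots>; k\<^sub>1, \<dots>)\<close>: the number of constant symbols and the lists of
  arities of the operation and relation symbols. Symbols, registers and labels are all numbered
  from 1, as in the mathematics, whereas lists and streams are indexed from 0.\<close>

record signature =
  num_constants :: nat
  op_arities :: "nat list"
  rel_arities :: "nat list"

datatype instruction =
    Apply_Op nat nat "nat list"         \<comment> \<open>\<open>Apply_Op j i js\<close>: \<open>Z\<^sub>j := f\<^sub>i(Z\<^bsub>js\<^esub>)\<close>\<close>
  | Load_Const nat nat                  \<comment> \<open>\<open>Load_Const j i\<close>: \<open>Z\<^sub>j := c\<^sub>i\<close>\<close>
  | Copy nat nat                        \<comment> \<open>\<open>Copy j k\<close>: the register addressed by \<open>I\<^sub>j\<close> receives the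
      content of the one addressed by \<open>I\<^sub>k\<close>\<close>
  | If_Rel nat "nat list" nat nat       \<comment> \<open>\<open>If_Rel i js l1 l2\<close>: if \<open>r\<^sub>i(Z\<^bsub>js\<^esub>)\<close> then goto \<open>l1\<close> else goto \<open>l2\<close>\<close>
  | If_Index_Eq nat nat nat nat         \<comment> \<open>\<open>If_Index_Eq j k l1 l2\<close>: if \<open>I\<^sub>j = I\<^sub>k\<close> then goto \<open>l1\<close> else goto \<open>l2\<close>\<close>
  | Index_One nat                       \<comment> \<open>\<open>I\<^sub>j := 1\<close>\<close>
  | Index_Incr nat                      \<comment> \<open>\<open>I\<^sub>j := I\<^sub>j + 1\<close>\<close>
  | Goto_Or nat nat                     \<comment> \<open>goto \<open>l1\<close> or goto \<open>l2\<close>\<close>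
  | Stop

type_synonym program = "instruction list"

text \<open>\<open>wf_instruction \<sigma> L i\<close>: \<open>i\<close> is an admissible non-stop instruction over \<open>\<sigma>\<close> with jump
  targets in the label set \<open>L\<close>.\<close>

fun wf_instruction :: "signature \<Rightarrow> nat set \<Rightarrow> instruction \<Rightarrow> bool" where
  "wf_instruction \<sigma> L (Apply_Op j i js) \<longleftrightarrow>
     1 \<le> j \<and> i \<in> {1..length (op_arities \<sigma>)} \<and> length js = op_arities \<sigma> ! (i - 1) \<and> (\<forall>k \<in> set js. 1 \<le> k)"
| "wf_instruction \<sigma> L (Load_Const j i) \<longleftrightarrow> 1 \<le> j \<and> i \<in> {1..num_constants \<sigma>}"
| "wf_instruction \<sigma> L (Copy j k) \<longleftrightarrow> 1 \<le> j \<and> 1 \<le> k"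
| "wf_instruction \<sigma> L (If_Rel i js l1 l2) \<longleftrightarrow>
     i \<in> {1..length (rel_arities \<sigma>)} \<and> length js = rel_arities \<sigma> ! (i - 1) \<and> (\<forall>k \<in> set js. 1 \<le> k) \<and>
     l1 \<in> L \<and> l2 \<in> L"
| "wf_instruction \<sigma> L (If_Index_Eq j k l1 l2) \<longleftrightarrow> 1 \<le> j \<and> 1 \<le> k \<and> l1 \<in> L \<and> l2 \<in> L"
| "wf_instruction \<sigma> L (Index_One j) \<longleftrightarrow> 1 \<le> j"
| "wf_instruction \<sigma> L (Index_Incr j) \<longleftrightarrow> 1 \<le> j"
| "wf_instruction \<sigma> L (Goto_Or l1 l2) \<longleftrightarrow> l1 \<in> L \<and> l2 \<in> L"
| "wf_instruction \<sigma> L Stop \<longleftrightarrow> False"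

definition last_label :: "program \<Rightarrow> nat" where
  "last_label P = length P"

definition labels :: "program \<Rightarrow> nat set" where
  "labels P = {1..last_label P}"

definition inner_labels :: "program \<Rightarrow> nat set" where
  "inner_labels P = {1..<last_label P}"

definition instr_at :: "program \<Rightarrow> nat \<Rightarrow> instruction" where
  "instr_at P l = P ! (l - 1)"

definition is_program :: "signature \<Rightarrow> program \<Rightarrow> bool" where
  "is_program \<sigma> P \<longleftrightarrow>
     1 \<le> last_label P \<and>
     (\<forall>l \<in> inner_labels P. wf_instruction \<sigma> (labels P) (instr_at P l)) \<and>
     instr_at P (last_label P) = Stop"

fun branch_targets :: "instruction \<Rightarrow> (nat \<times> nat) option" where
  "branch_targets (If_Rel i js l1 l2) = Some (l1, l2)"
| "branch_targets (If_Index_Eq j k l1 l2) = Some (l1, l2)"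
| "branch_targets (Goto_Or l1 l2) = Some (l1, l2)"
| "branch_targets _ = None"

definition branch_labels :: "program \<Rightarrow> nat set" where
  "branch_labels P = {l \<in> inner_labels P. branch_targets (instr_at P l) \<noteq> None}"

definition nonbranch_labels :: "program \<Rightarrow> nat set" where
  "nonbranch_labels P = inner_labels P - branch_labels P"

text \<open>The three successor functions are meaningful only on \<^const>\<open>nonbranch_labels\<close>
  and \<^const>\<open>branch_labels\<close>, respectively.\<close>

definition beta :: "program \<Rightarrow> nat \<Rightarrow> nat" where
  "beta P l = l + 1"

definition beta_pos :: "program \<Rightarrow> nat \<Rightarrow> nat" where
  "beta_pos P l = fst (the (branch_targets (instr_at P l)))"

definition beta_neg :: "program \<Rightarrow> nat \<Rightarrow> nat" where
  "beta_neg P l = snd (the (branch_targets (instr_at P l)))"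

definition successor_rule :: "program \<Rightarrow> nat \<Rightarrow> nat \<Rightarrow> bool" where
  "successor_rule P l l' \<longleftrightarrow>
     (l \<in> nonbranch_labels P \<longrightarrow> l' = beta P l) \<and>
     (l \<in> branch_labels P \<longrightarrow> l' \<in> {beta_pos P l, beta_neg P l})"

datatype label_seq = Fin_Seq "nat list" | Inf_Seq "nat stream"

fun seq_length :: "label_seq \<Rightarrow> enat" where
  "seq_length (Fin_Seq ls) = enat (length ls)"
| "seq_length (Inf_Seq ls) = \<infinity>"

text \<open>\<open>label_at B t\<close> is the \<open>t\<close>-th entry, counted from \<open>t = 1\<close>.\<close>

fun label_at :: "label_seq \<Rightarrow> nat \<Rightarrow> nat" where
  "label_at (Fin_Seq ls) t = ls ! (t - 1)"
| "label_at (Inf_Seq ls) t = ls !! (t - 1)"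

definition finite_path :: "program \<Rightarrow> nat list \<Rightarrow> bool" where
  "finite_path P ls \<longleftrightarrow>
     (let s = length ls; B = Fin_Seq ls in
       1 \<le> s \<and> set ls \<subseteq> labels P \<and>
       label_at B 1 = 1 \<and> label_at B s = last_label P \<and>
       (\<forall>t \<in> {1..<s}. label_at B t \<in> inner_labels P \<and>
          successor_rule P (label_at B t) (label_at B (t + 1))))"

definition infinite_path :: "program \<Rightarrow> nat stream \<Rightarrow> bool" where
  "infinite_path P ls \<longleftrightarrow>
     (let B = Inf_Seq ls in
       label_at B 1 = 1 \<and>
       (\<forall>t \<ge> 1. label_at B t \<in> inner_labels P \<and>
          successor_rule P (label_at B t) (label_at B (t + 1))))"

definition Lab :: "program \<Rightarrow> label_seq set" where
  "Lab P = {Fin_Seq ls | ls. finite_path P ls} \<union> {Inf_Seq ls | ls. infinite_path P ls}"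

text \<open>\<^const>\<open>beta_pos\<close> and \<^const>\<open>beta_neg\<close> are partial, so the branching condition on the
  common predecessor label is made explicit; for two paths it follows from their
  being different at \<open>j\<close>.\<close>

definition path_less :: "program \<Rightarrow> label_seq \<Rightarrow> label_seq \<Rightarrow> bool" where
  "path_less P B1 B2 \<longleftrightarrow>
     (\<exists>j \<ge> 2. enat j \<le> seq_length B1 \<and> enat j \<le> seq_length B2 \<and>
        (\<forall>i \<in> {1..j - 1}. label_at B1 i = label_at B2 i) \<and>
        label_at B1 j \<noteq> label_at B2 j \<and>
        label_at B1 (j - 1) \<in> branch_labels P \<and>
        label_at B1 j = beta_pos P (label_at B1 (j - 1)) \<and>
        label_at B2 j = beta_neg P (label_at B1 (j - 1)))"

definition path_le :: "program \<Rightarrow> label_seq \<Rightarrow> label_seq \<Rightarrow> bool" where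
  "path_le P B1 B2 \<longleftrightarrow> path_less P B1 B2 \<or> B1 = B2"

end

theory Submission
  imports Defs
begin

text \<open>A path is determined by its choices at the branch labels. Record at each step the digit 1
  if the path leaves a branch label other than by the positive successor, and the digit 0
  otherwise, and read the digits in base 3. Only the digits 0 and 1 occur, so numerical order is
  lexicographic order. Two distinct paths have a first difference inside both of them, since a
  finite path ends at the only non-inner label and hence is never a proper prefix of another
  path.\<close>

definition base3 :: "nat set \<Rightarrow> real" where
  "base3 A = (\<Sum>t. of_bool (t \<in> A) * (1/3)^t)"

lemma summable_base3: "summable (\<lambda>t. of_bool (t \<in> A) * (1/3 :: real)^t)"
  by (rule summable_comparison_test'[where N = 0 and g = "\<lambda>t. (1/3 :: real)^t"]) auto

text \<open>The digit at place \<open>n\<close> gives \<open>B\<close> a gain of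
  \<open>(1/3)^n\<close>, while all later digits of \<open>A\<close> together add at most half of
  that. In base 2 the later digits could make up the whole gain and strictness would fail.\<close>

lemma base3_less:
  assumes eq: "\<And>i. i < n \<Longrightarrow> i \<in> A \<longleftrightarrow> i \<in> B" and "n \<notin> A" and "n \<in> B"
  shows "base3 A < base3 B"
proof -
  let ?d = "\<lambda>S t. of_bool (t \<in> S) * (1/3 :: real)^t"
  let ?s = "\<Sum>t<n. ?d B t"
  have prefix: "(\<Sum>t<n. ?d A t) = ?s"
    by (rule sum.cong) (auto simp: eq)
  have split: "base3 S = (\<Sum>t. ?d S (t + Suc n)) + (\<Sum>t<Suc n. ?d S t)" for S
    unfolding base3_def using summable_base3 by (rule suminf_split_initial_segment)
  have geo: "(\<lambda>t. (1/3)^Suc n * (1/3 :: real)^t) sums ((1/3)^Suc n * (1 / (1 - 1/3)))"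
    by (intro sums_mult geometric_sums) simp
  \<comment> \<open>Worst case: every digit of \<open>A\<close> after place \<open>n\<close> is
    1.\<close>
  have "(\<Sum>t. ?d A (t + Suc n)) \<le> (\<Sum>t. (1/3)^Suc n * (1/3)^t)"
    using geo summable_base3
    by (intro suminf_le summable_ignore_initial_segment)
       (auto simp: power_add sums_iff)
  also have "\<dots> = (1/3)^n / 2"
    using geo by (simp add: sums_iff)
  also have "\<dots> < (1/3)^n"
    by simp
  finally have "base3 A < ?s + (1/3)^n"
    using \<open>n \<notin> A\<close> by (simp add: split prefix)
  also have "\<dots> \<le> base3 B"
  proof -
    have "0 \<le> (\<Sum>t. ?d B (t + Suc n))"
      by (intro suminf_nonneg summable_ignore_initial_segment summable_base3) simp
    then show ?thesis
      using \<open>n \<in> B\<close> by (simp add: split)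
  qed
  finally show ?thesis .
qed

text \<open>Position 0 stands for the step from the first to the second entry.\<close>

definition negative_steps :: "program \<Rightarrow> label_seq \<Rightarrow> nat set" where
  "negative_steps P B = {t. enat (t + 2) \<le> seq_length B \<and>
     label_at B (t + 1) \<in> branch_labels P \<and> label_at B (t + 2) \<noteq> beta_pos P (label_at B (t + 1))}"

text \<open>If \<open>j\<close> decides \<open>path_less\<close>, then \<open>j - 2\<close> is the
  first place where the digits differ: earlier digits depend only on entries before
  \<open>j\<close>, where the paths agree.\<close>

lemma path_less_imp_base3_less:
  assumes "path_less P B1 B2"
  shows "base3 (negative_steps P B1) < base3 (negative_steps P B2)"
proof -
  obtain j where j: "j \<ge> 2" "enat j \<le> seq_length B1" "enat j \<le> seq_length B2"
      "\<And>i. 1 \<le> i \<Longrightarrow> i < j \<Longrightarrow> label_at B1 i = label_at B2 i" "label_at B1 j \<noteq> label_at B2 j"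
      "label_at B1 (j - 1) \<in> branch_labels P" "label_at B1 j = beta_pos P (label_at B1 (j - 1))"
    using assms unfolding path_less_def by fastforce
  obtain n where n: "j = n + 2"
    using \<open>j \<ge> 2\<close> by (metis add.commute le_Suc_ex)
  show ?thesis
  proof (rule base3_less[where n = n])
    show "i \<in> negative_steps P B1 \<longleftrightarrow> i \<in> negative_steps P B2" if "i < n" for i
    proof -
      have "enat (i + 2) \<le> enat j"
        using that n by simp
      then have "enat (i + 2) \<le> seq_length B1" "enat (i + 2) \<le> seq_length B2"
        using j(2,3) by (blast intro: order_trans)+
      then show ?thesis
        using that n j(4)[of "i + 1"] j(4)[of "i + 2"] by (simp add: negative_steps_def)
    qed
    show "n \<notin> negative_steps P B1"
      using j n by (simp add: negative_steps_def)
    \<comment> \<open>Here \<open>B2\<close> leaves the same branch label as \<open>B1\<close>, but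
      its entry differs from that of \<open>B1\<close>, which is the positive successor.\<close>
    show "n \<in> negative_steps P B2"
      using j n j(4)[of "n + 1"] by (simp add: negative_steps_def)
  qed
qed

lemma Lab_first:
  assumes "B \<in> Lab P"
  shows "label_at B 1 = 1"
  using assms by (auto simp: Lab_def finite_path_def infinite_path_def Let_def)

lemma Lab_step:
  assumes "B \<in> Lab P" "1 \<le> t" "enat t < seq_length B"
  shows "label_at B t \<in> inner_labels P" "successor_rule P (label_at B t) (label_at B (t + 1))"
  using assms by (auto simp: Lab_def finite_path_def infinite_path_def Let_def)

lemma Lab_last:
  assumes "B \<in> Lab P" "seq_length B = enat s"
  shows "1 \<le> s" "label_at B s = last_label P"
  using assms by (auto simp: Lab_def finite_path_def Let_def)

lemma label_seq_eqI:
  assumes len: "seq_length B1 = seq_length B2"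
    and eq: "\<And>t. 1 \<le> t \<Longrightarrow> enat t \<le> seq_length B1 \<Longrightarrow> label_at B1 t = label_at B2 t"
  shows "B1 = B2"
proof (cases B1)
  case (Fin_Seq xs)
  then obtain ys where ys: "B2 = Fin_Seq ys"
    using len by (cases B2) auto
  have "xs ! i = ys ! i" if "i < length xs" for i
    using eq[of "Suc i"] that Fin_Seq ys by simp
  then show ?thesis
    using len Fin_Seq ys by (simp add: list_eq_iff_nth_eq)
next
  case (Inf_Seq xs)
  then obtain ys where ys: "B2 = Inf_Seq ys"
    using len by (cases B2) auto
  have "xs !! i = ys !! i" for i
    using eq[of "Suc i"] Inf_Seq ys by simp
  \<comment> \<open>Inserting \<open>id\<close> turns \<open>smap_alt\<close> into extensionality of
    streams.\<close>
  then have "smap id xs = ys"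
    by (simp add: smap_alt)
  then show ?thesis
    using Inf_Seq ys by (simp add: stream.map_id)
qed

text \<open>A finite path ends at \<open>last_label P\<close>, whereas a path that continues beyond
  that position must have an inner label there.\<close>

lemma Lab_not_shorter:
  assumes "B1 \<in> Lab P" "B2 \<in> Lab P"
    and eq: "\<And>t. 1 \<le> t \<Longrightarrow> enat t \<le> seq_length B1 \<Longrightarrow> enat t \<le> seq_length B2 \<Longrightarrow>
      label_at B1 t = label_at B2 t"
  shows "\<not> seq_length B1 < seq_length B2"
proof
  assume less: "seq_length B1 < seq_length B2"
  then obtain s where s: "seq_length B1 = enat s"
    by (metis enat_ord_simps(6) not_enat_eq)
  note Lab_last[OF \<open>B1 \<in> Lab P\<close> s]
  moreover have "label_at B2 s \<in> inner_labels P"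
    using Lab_step(1) \<open>B2 \<in> Lab P\<close> less s \<open>1 \<le> s\<close> by metis
  ultimately show False
    using eq[of s] less s by (simp add: inner_labels_def)
qed

text \<open>At the first difference both paths leave a common label by different successors. That
  label must then be a branch label, and one path takes its positive and the other its negative
  successor.\<close>

lemma Lab_total:
  assumes B: "B1 \<in> Lab P" "B2 \<in> Lab P" and "B1 \<noteq> B2"
  shows "path_less P B1 B2 \<or> path_less P B2 B1"
proof -
  define differ where "differ t \<longleftrightarrow> 1 \<le> t \<and> enat t \<le> seq_length B1 \<and> enat t \<le> seq_length B2 \<and>
    label_at B1 t \<noteq> label_at B2 t" for t
  have "\<exists>t. differ t"
  proof (rule ccontr)
    assume "\<nexists>t. differ t"
    then have eq: "\<And>t. 1 \<le> t \<Longrightarrow> enat t \<le> seq_length B1 \<Longrightarrow> enat t \<le> seq_length B2 \<Longrightarrow>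
        label_at B1 t = label_at B2 t"
      unfolding differ_def by blast
    have "seq_length B1 = seq_length B2"
      using Lab_not_shorter[OF B] Lab_not_shorter[OF B(2,1)] eq by (metis linorder_neqE)
    then have "B1 = B2"
      using eq by (intro label_seq_eqI) auto
    with \<open>B1 \<noteq> B2\<close> show False by contradiction
  qed
  define j where "j = (LEAST t. differ t)"
  have "differ j"
    unfolding j_def using \<open>\<exists>t. differ t\<close> by (rule LeastI_ex)
  then have j: "1 \<le> j" "enat j \<le> seq_length B1" "enat j \<le> seq_length B2"
      "label_at B1 j \<noteq> label_at B2 j"
    by (auto simp: differ_def)
  \<comment> \<open>All paths start with label 1, so the first difference has a predecessor.\<close>
  have "j \<noteq> 1"
    using j(4) Lab_first[OF B(1)] Lab_first[OF B(2)] by auto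
  with j(1) have "j \<ge> 2" by simp
  have below: "label_at B1 i = label_at B2 i" if "1 \<le> i" "i < j" for i
  proof -
    have "enat i \<le> enat j"
      using that by simp
    then have "enat i \<le> seq_length B1" "enat i \<le> seq_length B2"
      using j by (blast intro: order_trans)+
    moreover have "\<not> differ i"
      using that unfolding j_def by (blast dest: not_less_Least)
    ultimately show ?thesis
      using that by (simp add: differ_def)
  qed
  define l where "l = label_at B1 (j - 1)"
  have l2: "label_at B2 (j - 1) = l"
    using below[of "j - 1"] \<open>j \<ge> 2\<close> by (simp add: l_def)
  have "enat (j - 1) < enat j"
    using \<open>j \<ge> 2\<close> by simp
  then have len: "enat (j - 1) < seq_length B1" "enat (j - 1) < seq_length B2"
    using j by (blast intro: less_le_trans)+
  have step: "l \<in> inner_labels P" "successor_rule P l (label_at B1 j)"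
      "successor_rule P l (label_at B2 j)"
    using Lab_step[OF B(1) _ len(1)] Lab_step(2)[OF B(2) _ len(2)] \<open>j \<ge> 2\<close> l2
    by (auto simp: l_def)
  \<comment> \<open>At a nonbranch label both entries at \<open>j\<close> would equal
    \<open>beta P l\<close>.\<close>
  then have branch: "l \<in> branch_labels P"
    using j(4) by (auto simp: successor_rule_def nonbranch_labels_def)
  then have "label_at B1 j \<in> {beta_pos P l, beta_neg P l}"
      "label_at B2 j \<in> {beta_pos P l, beta_neg P l}"
    using step by (auto simp: successor_rule_def)
  with j(4) consider
      "label_at B1 j = beta_pos P l" "label_at B2 j = beta_neg P l"
    | "label_at B2 j = beta_pos P l" "label_at B1 j = beta_neg P l"
    by auto
  then show ?thesis
  proof cases
    case 1
    then have "path_less P B1 B2"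
      unfolding path_less_def using \<open>j \<ge> 2\<close> j below branch l_def by (intro exI[of _ j]) auto
    then show ?thesis ..
  next
    case 2
    then have "path_less P B2 B1"
      unfolding path_less_def using \<open>j \<ge> 2\<close> j below branch l2 by (intro exI[of _ j]) auto
    then show ?thesis ..
  qed
qed

theorem theorem4p23:
  fixes \<sigma> :: signature and P :: program
  assumes "is_program \<sigma> P"
  shows "\<exists>f :: label_seq \<Rightarrow> real. inj_on f (Lab P) \<and>
           (\<forall>B1 \<in> Lab P. \<forall>B2 \<in> Lab P. path_le P B1 B2 \<longleftrightarrow> f B1 \<le> f B2)"
proof -
  define f where "f B = base3 (negative_steps P B)" for B
  have mono: "f B1 < f B2" if "path_less P B1 B2" for B1 B2
    using path_less_imp_base3_less[OF that] by (simp add: f_def)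
  \<comment> \<open>Distinct paths are comparable, so strict monotonicity separates their
    values.\<close>
  have "inj_on f (Lab P)"
    using Lab_total mono by (metis inj_onI order_less_irrefl)
  \<comment> \<open>Order is reflected because \<open>f B1 \<le> f B2\<close> rules out
    \<open>path_less P B2 B1\<close>, and totality leaves only
    \<open>path_le P B1 B2\<close>.\<close>
  moreover have "path_le P B1 B2 \<longleftrightarrow> f B1 \<le> f B2" if "B1 \<in> Lab P" "B2 \<in> Lab P" for B1 B2
    using Lab_total[OF that] mono[of B1 B2] mono[of B2 B1] by (auto simp: path_le_def)
  ultimately show ?thesis by blast
qed

end
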